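(* Let $K$ be a field of characteristic different from $2$, let $G$ be a group with neutral element $e$, let $n\ge 1$, and let $UT_n$ be endowed with the elementary $G$-grading defined by an $(n-1)$-tuple $(g_1,\dots,g_{n-1})$ of elements of $G$. Then an involution $\varphi:UT_n\to UT_n$ is homogeneous (i.e. $\theta$-homogeneous for some bijection $\theta$ of the support of the grading) if and only if the following two conditions hold. (1) For all $i,j\in\{1,\dots,n-1\}$, $k\in\{1,\dots,n-i\}$ and $l\in\{1,\dots,n-j\}$: if $g_i g_{i+1}\cdots g_{i+k-1}=g_j g_{j+1}\cdots g_{j+l-1}$, then $g_{n-i-k+1}\cdots g_{n-i}=g_{n-j-l+1}\cdots g_{n-j}$ (products taken with indices increasing by one from left to right). (2) There exists an invertible matrix $P\in UT_n$, homogeneous of degree $e$, such that $\varphi(X)=P^{-1}X^\circ P$ for every $X\in UT_n$, where $P$ satisfies $P^\circ=P$ or $P^\circ=-P$ if $n$ is even, and $P^\circ=P$ if $n$ is odd.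
   Context: $UT_n$ is the associative $K$-algebra of $n\times n$ upper triangular matrices over $K$, with matrix units $E_{i,j}$ ($i\le j$). A $G$-grading $\Gamma$ on an algebra $A$ is a decomposition $A=\bigoplus_{g\in G}A_g$ into subspaces with $A_gA_h\subseteq A_{gh}$ for all $g,h\in G$; its support is $\mathrm{Supp}\,\Gamma=\{g\in G: A_g\neq\{0\}\}$; an element of $A_g$ is called homogeneous of degree $g$. The elementary $G$-grading on $UT_n$ defined by $(g_1,\dots,g_{n-1})\in G^{n-1}$ is the grading in which each matrix unit is homogeneous, $\deg E_{i,i}=e$ and $\deg E_{i,i+k}=g_i g_{i+1}\cdots g_{i+k-1}$ for $1\le i\le n-1$, $1\le k\le n-i$; that is, $A_g$ is the span of the matrix units of degree $g$. An involution of an algebra $A$ is a linear map $\varphi:A\to A$ with $\varphi(xy)=\varphi(y)\varphi(x)$ for all $x,y$ and $\varphi^2=\mathrm{id}$. The canonical involution (reflection involution) $\circ$ on $UT_n$ is the linear map with $E_{i,j}^\circ=E_{n-j+1,n-i+1}$ for $1\le i\le j\le n$. An involution $\varphi:A\to A$ is $\theta$-homogeneous, for a bijection $\theta:\mathrm{Supp}\,\Gamma\to\mathrm{Supp}\,\Gamma$, if $\varphi(A_g)=A_{\theta(g)}$ for every $g\in\mathrm{Supp}\,\Gamma$; it is homogeneous if it is $\theta$-homogeneous for some such bijection $\theta$. *)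

theory Defs
  imports "Jordan_Normal_Form.VS_Connect" "HOL-Algebra.Group"
begin

definition UT :: "nat \<Rightarrow> 'k::field mat set" where
  "UT n = {A \<in> carrier_mat n n. upper_triangular A}"

text \<open>Matrix units are indexed from 1, as in the mathematical notation, whereas entries of
  matrices are accessed from 0.\<close>

definition mat_unit :: "nat \<Rightarrow> nat \<Rightarrow> nat \<Rightarrow> 'k::field mat" where
  "mat_unit n i j = mat n n (\<lambda>(r, c). if r + 1 = i \<and> c + 1 = j then 1 else 0)"

text \<open>The ordered product \<open>g i \<otimes> g (i + 1) \<otimes> \<dots> \<otimes> g (i + k - 1)\<close>; it is the neutral element
  for \<open>k = 0\<close>.\<close>

definition seg_prod :: "('g, 'm) monoid_scheme \<Rightarrow> (nat \<Rightarrow> 'g) \<Rightarrow> nat \<Rightarrow> nat \<Rightarrow> 'g" where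
  "seg_prod G g i k = foldr (mult G) (map g [i..<i + k]) (one G)"

definition elementary_grading ::
  "('g, 'm) monoid_scheme \<Rightarrow> nat \<Rightarrow> (nat \<Rightarrow> 'g) \<Rightarrow> 'g \<Rightarrow> 'k::field mat set" where
  "elementary_grading G n g h =
     LinearCombinations.module.span class_ring (module_mat TYPE('k) n n)
       {mat_unit n i (i + k) | i k. 1 \<le> i \<and> i + k \<le> n \<and> seg_prod G g i k = h}"

definition grading_supp ::
  "('g, 'm) monoid_scheme \<Rightarrow> nat \<Rightarrow> ('g \<Rightarrow> 'k::field mat set) \<Rightarrow> 'g set" where
  "grading_supp G n \<Gamma> = {h \<in> carrier G. \<Gamma> h \<noteq> {0\<^sub>m n n}}"

text \<open>The linear map sending the matrix unit at position \<open>(i, j)\<close> to the one at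
  \<open>(n - j + 1, n - i + 1)\<close>, see \<open>reflection_mat_unit\<close> and \<open>reflection_linear\<close> below.\<close>

definition reflection :: "nat \<Rightarrow> 'k::field mat \<Rightarrow> 'k mat" where
  "reflection n A = mat n n (\<lambda>(r, c). A $$ (n - 1 - c, n - 1 - r))"

text \<open>Maps on \<open>UT n\<close> are modelled by functions on all matrices whose values outside \<open>UT n\<close> are
  irrelevant.\<close>

definition UT_involution :: "nat \<Rightarrow> ('k::field mat \<Rightarrow> 'k mat) \<Rightarrow> bool" where
  "UT_involution n \<phi> \<longleftrightarrow>
     \<phi> \<in> UT n \<rightarrow> UT n \<and>
     (\<forall>X\<in>UT n. \<forall>Y\<in>UT n. \<phi> (X + Y) = \<phi> X + \<phi> Y) \<and>
     (\<forall>c. \<forall>X\<in>UT n. \<phi> (c \<cdot>\<^sub>m X) = c \<cdot>\<^sub>m \<phi> X) \<and>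
     (\<forall>X\<in>UT n. \<forall>Y\<in>UT n. \<phi> (X * Y) = \<phi> Y * \<phi> X) \<and>
     (\<forall>X\<in>UT n. \<phi> (\<phi> X) = X)"

definition theta_homogeneous ::
  "('g, 'm) monoid_scheme \<Rightarrow> nat \<Rightarrow> ('g \<Rightarrow> 'k::field mat set) \<Rightarrow> ('g \<Rightarrow> 'g) \<Rightarrow> ('k mat \<Rightarrow> 'k mat) \<Rightarrow> bool"
  where
  "theta_homogeneous G n \<Gamma> \<theta> \<phi> \<longleftrightarrow>
     bij_betw \<theta> (grading_supp G n \<Gamma>) (grading_supp G n \<Gamma>) \<and>
     (\<forall>h\<in>grading_supp G n \<Gamma>. \<phi> ` \<Gamma> h = \<Gamma> (\<theta> h))"

definition homogeneous_map ::
  "('g, 'm) monoid_scheme \<Rightarrow> nat \<Rightarrow> ('g \<Rightarrow> 'k::field mat set) \<Rightarrow> ('k mat \<Rightarrow> 'k mat) \<Rightarrow> bool" where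
  "homogeneous_map G n \<Gamma> \<phi> \<longleftrightarrow> (\<exists>\<theta>. theta_homogeneous G n \<Gamma> \<theta> \<phi>)"

lemma reflection_mat_unit:
  assumes "1 \<le> i" "i \<le> j" "j \<le> n"
  shows "reflection n (mat_unit n i j) = mat_unit n (n - j + 1) (n - i + 1)"
  using assms by (intro eq_matI) (auto simp: reflection_def mat_unit_def)

lemma reflection_linear:
  assumes "A \<in> carrier_mat n n" "B \<in> carrier_mat n n"
  shows "reflection n (A + B) = reflection n A + reflection n B"
    and "reflection n (c \<cdot>\<^sub>m A) = c \<cdot>\<^sub>m reflection n A"
  using assms by (auto intro!: eq_matI simp: reflection_def)

lemma elementary_grading_iff:
  fixes A :: "'k::field mat"
  shows "A \<in> elementary_grading G n g h \<longleftrightarrow>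
    A \<in> UT n \<and> (\<forall>r c. r \<le> c \<longrightarrow> c < n \<longrightarrow> A $$ (r, c) \<noteq> 0 \<longrightarrow> seg_prod G g (r + 1) (c - r) = h)"
proof -
  interpret V: matrix_vs n n "TYPE('k)" .
  let ?S = "{mat_unit n i (i + k) | i k. 1 \<le> i \<and> i + k \<le> n \<and> seg_prod G g i k = h} :: 'k mat set"
  let ?W = "{A :: 'k mat. A \<in> UT n \<and>
    (\<forall>r c. r \<le> c \<longrightarrow> c < n \<longrightarrow> A $$ (r, c) \<noteq> 0 \<longrightarrow> seg_prod G g (r + 1) (c - r) = h)}"
  have Sc: "?S \<subseteq> carrier_mat n n" by (auto simp: mat_unit_def)
  have W: "submodule class_ring ?W V.V"
    apply (rule LinearCombinations.submodule.intro)
    by (auto simp: UT_def upper_triangular_def module_mat_simps V.module_axioms)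
       (metis add.right_neutral)
  have SW: "?S \<subseteq> ?W"
  proof
    fix B :: "'k mat" assume "B \<in> ?S"
    then obtain i k where B: "B = mat_unit n i (i + k)" "1 \<le> i" "i + k \<le> n" "seg_prod G g i k = h"
      by blast
    have "seg_prod G g (r + 1) (c - r) = h" if "r \<le> c" "c < n" "B $$ (r, c) \<noteq> 0" for r c
    proof -
      have "r + 1 = i \<and> c + 1 = i + k" using that B(1) by (simp add: mat_unit_def split: if_splits)
      then have "r + 1 = i" "c - r = k" by auto
      then show ?thesis using B(4) by simp
    qed
    moreover have "B \<in> UT n" by (auto simp: B(1) UT_def mat_unit_def)
    ultimately show "B \<in> ?W" by blast
  qed
  have sub1: "V.span ?S \<subseteq> ?W" using V.span_is_subset[OF SW W] .
  have sub2: "A \<in> V.span ?S" if A: "A \<in> ?W" for A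
  proof -
    have sub: "submodule class_ring (V.span ?S) V.V"
      using V.span_is_submodule[of ?S] Sc by simp
    have z: "0\<^sub>m n n \<in> V.span ?S"
      using submodule.zero_closed[OF sub] by (simp add: module_mat_simps)
    have pl: "x + y \<in> V.span ?S" if "x \<in> V.span ?S" "y \<in> V.span ?S" for x y
      using submodule.m_closed[OF sub] that by (simp add: module_mat_simps)
    have sm: "c \<cdot>\<^sub>m x \<in> V.span ?S" if "x \<in> V.span ?S" for c x
      using submodule.smult_closed[OF sub, of c] that by (simp add: module_mat_simps)
    have "mat n n (\<lambda>(r, c). if (r, c) \<in> F then A $$ (r, c) else 0) \<in> V.span ?S"
      if "finite F" "F \<subseteq> {..<n} \<times> {..<n}" for F using that
    proof induction
      case empty
      have "mat n n (\<lambda>(r, c). if (r, c) \<in> {} then A $$ (r, c) else 0) = 0\<^sub>m n n" by auto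
      then show ?case using z by (simp only:)
    next
      case (insert p F)
      obtain r c where p: "p = (r, c)" by force
      let ?M = "\<lambda>F. mat n n (\<lambda>(r, c). if (r, c) \<in> F then A $$ (r, c) else 0)"
      show ?case
      proof (cases "A $$ (r, c) = 0")
        case True
        have "?M (insert p F) = ?M F" using True by (auto simp: p)
        moreover have "?M F \<in> V.span ?S" using insert by blast
        ultimately show ?thesis by (simp only:)
      next
        case False
        have rc: "r < n" "c < n" using insert p by auto
        have "dim_row A = n" "upper_triangular A" using A by (auto simp: UT_def)
        then have "A $$ (r, c) = 0" if "c < r" using upper_triangularD[of A c r] rc that by simp
        then have le: "r \<le> c" using False by fastforce
        have "seg_prod G g (r + 1) (c - r) = h" using A False rc(2) le by blast
        moreover have "1 \<le> r + 1" "(r + 1) + (c - r) \<le> n" using rc le by auto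
        ultimately have "mat_unit n (r + 1) ((r + 1) + (c - r)) \<in> ?S" by blast
        then have u: "mat_unit n (r + 1) ((r + 1) + (c - r)) \<in> V.span ?S"
          using V.in_own_span[of ?S] Sc by (meson subsetD)
        have eq: "?M (insert p F) = ?M F + A $$ (r, c) \<cdot>\<^sub>m mat_unit n (r + 1) ((r + 1) + (c - r))"
          using rc le insert(2) by (intro eq_matI) (auto simp: mat_unit_def p)
        have MF: "?M F \<in> V.span ?S" using insert by blast
        show ?thesis unfolding eq by (rule pl[OF MF sm[OF u]])
      qed
    qed
    from this[of "{..<n} \<times> {..<n}"]
    have "mat n n (\<lambda>(r, c). if (r, c) \<in> {..<n} \<times> {..<n} then A $$ (r, c) else 0) \<in> V.span ?S" by blast
    moreover have "mat n n (\<lambda>(r, c). if (r, c) \<in> {..<n} \<times> {..<n} then A $$ (r, c) else 0) = A"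
      using A by (intro eq_matI) (auto simp: UT_def)
    ultimately show ?thesis by (simp only:)
  qed
  have "V.span ?S = ?W"
    by (rule equalityI[OF sub1], rule subsetI, erule sub2)
  then show ?thesis unfolding elementary_grading_def by (simp only: mem_Collect_eq)
qed

end

theory Submission
  imports Defs "Jordan_Normal_Form.Determinant"
begin

text \<open>The map \<open>\<psi> X = \<phi> (X\<^sup>\<circ>)\<close> is an automorphism of \<open>UT n\<close>. The matrix \<open>P\<close> whose row \<open>r\<close> is
  the first row of \<open>\<psi> (E\<^sub>1\<^sub>r)\<close> satisfies \<open>P * \<psi> X = X * P\<close>, and it is upper triangular with nonzero
  diagonal, so \<open>\<phi> X = P\<inverse> * X\<^sup>\<circ> * P\<close>. If \<open>\<phi>\<close> is homogeneous, then the nonzero entries of row \<open>r\<close>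
  of \<open>P\<close> come from a single homogeneous element, so their columns \<open>c\<close> satisfy
  \<open>deg E\<^sub>1\<^sub>c = deg E\<^sub>1\<^sub>r\<close>, that is, \<open>deg E\<^sub>r\<^sub>c = e\<close>; hence \<open>P\<close> has degree \<open>e\<close>. Since \<open>\<phi>\<close> is an
  involution, \<open>P\<inverse> * P\<^sup>\<circ>\<close> is central, so \<open>P\<^sup>\<circ>\<close> is a scalar multiple of \<open>P\<close>, and the scalar is \<open>1\<close>
  or \<open>-1\<close>. For odd \<open>n\<close> the central entry of \<open>P\<close>, which the reflection fixes, forces it to be \<open>1\<close>.\<close>

section \<open>Arithmetic of triangular matrices and matrix units\<close>

lemma UT_index_zero: "A \<in> UT n \<Longrightarrow> c < r \<Longrightarrow> r < n \<Longrightarrow> A $$ (r, c) = 0"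
  by (auto simp: UT_def upper_triangular_def)

lemma UT_carrier: "A \<in> UT n \<Longrightarrow> A \<in> carrier_mat n n"
  by (simp add: UT_def)

lemma UT_I:
  assumes "A \<in> carrier_mat n n" "\<And>r c. c < r \<Longrightarrow> r < n \<Longrightarrow> A $$ (r, c) = 0"
  shows "A \<in> UT n"
  using assms by (auto simp: UT_def upper_triangular_def)

lemma index_mult_mat_square:
  assumes "A \<in> carrier_mat n n" "B \<in> carrier_mat n n" "r < n" "c < n"
  shows "(A * B) $$ (r, c) = (\<Sum>s<n. A $$ (r, s) * B $$ (s, c))"
  using assms by (auto simp: scalar_prod_def atLeast0LessThan intro!: sum.cong)

declare index_mult_mat(1) [simp del]

lemma index_mult_mat_eq_zero:
  assumes "A \<in> carrier_mat n n" "B \<in> carrier_mat n n" "r < n" "c < n"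
    and "\<And>s. s < n \<Longrightarrow> A $$ (r, s) = 0 \<or> B $$ (s, c) = 0"
  shows "(A * B) $$ (r, c) = (0 :: 'a::semiring_1)"
proof -
  have "A $$ (r, s) * B $$ (s, c) = 0" if "s < n" for s
    using assms(5)[OF that] by auto
  then show ?thesis using assms(1-4) by (simp add: index_mult_mat_square)
qed

lemma UT_mult: "A \<in> UT n \<Longrightarrow> B \<in> UT n \<Longrightarrow> A * B \<in> UT n"
proof (rule UT_I)
  fix r c assume AB: "A \<in> UT n" "B \<in> UT n" and rc: "c < r" "r < n"
  have "A $$ (r, s) = 0 \<or> B $$ (s, c) = 0" if "s < n" for s
    using AB rc that by (cases "s < r") (auto simp: UT_index_zero)
  then show "(A * B) $$ (r, c) = 0"
    using AB rc by (intro index_mult_mat_eq_zero[of _ n]) (auto simp: UT_carrier)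
qed (auto simp: UT_def)

lemma UT_smult: "A \<in> UT n \<Longrightarrow> a \<cdot>\<^sub>m A \<in> UT n"
  by (rule UT_I) (auto simp: UT_index_zero UT_def)

text \<open>In the sum over \<open>s\<close>, the first factor vanishes for \<open>s < r\<close> and
  the second for \<open>s > r\<close>.\<close>

lemma UT_index_diag_mult:
  assumes "A \<in> UT n" "B \<in> UT n" "r < n"
  shows "(A * B) $$ (r, r) = A $$ (r, r) * B $$ (r, r)"
proof -
  have "A $$ (r, s) * B $$ (s, r) = (if s = r then A $$ (r, r) * B $$ (r, r) else 0)" if "s < n" for s
    using assms that by (cases s r rule: linorder_cases) (auto simp: UT_index_zero)
  then have "(\<Sum>s<n. A $$ (r, s) * B $$ (s, r)) =
      (\<Sum>s<n. if s = r then A $$ (r, r) * B $$ (r, r) else 0)"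
    by (intro sum.cong) auto
  then show ?thesis using assms by (simp add: index_mult_mat_square[of A n] UT_carrier)
qed

lemma mat_unit_UT: "i \<le> j \<Longrightarrow> mat_unit n i j \<in> UT n"
  by (rule UT_I) (auto simp: mat_unit_def)

text \<open>Units count from 1 and entries from 0; writing \<open>Suc\<close> makes the entry 1 sit
  at \<open>(i, j)\<close>.\<close>

lemma index_mat_unit:
  assumes "r < n" "c < n"
  shows "mat_unit n (Suc i) (Suc j) $$ (r, c) = (if r = i \<and> c = j then 1 else 0)"
  using assms by (simp add: mat_unit_def)

lemma mat_unit_carrier: "mat_unit n i j \<in> carrier_mat n n"
  by (simp add: mat_unit_def)

lemma mat_unit_dim [simp]: "dim_row (mat_unit n i j) = n" "dim_col (mat_unit n i j) = n"
  by (simp_all add: mat_unit_def)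

lemma index_mat_unit_mult:
  assumes "X \<in> carrier_mat n n" "r < n" "c < n" "j < n"
  shows "(mat_unit n (Suc i) (Suc j) * X) $$ (r, c) = (if r = i then X $$ (j, c) else 0)"
proof -
  have "mat_unit n (Suc i) (Suc j) $$ (r, s) * X $$ (s, c) =
      (if s = j then if r = i then X $$ (j, c) else 0 else 0)" if "s < n" for s
    using assms that by (simp add: index_mat_unit)
  then show ?thesis using assms by (simp add: index_mult_mat_square[OF mat_unit_carrier])
qed

lemma index_mult_mat_unit:
  assumes "X \<in> carrier_mat n n" "r < n" "c < n" "i < n"
  shows "(X * mat_unit n (Suc i) (Suc j)) $$ (r, c) = (if c = j then X $$ (r, i) else 0)"
proof -
  have "X $$ (r, s) * mat_unit n (Suc i) (Suc j) $$ (s, c) =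
      (if s = i then if c = j then X $$ (r, i) else 0 else 0)" if "s < n" for s
    using assms that by (simp add: index_mat_unit)
  then show ?thesis using assms by (simp add: index_mult_mat_square[OF _ mat_unit_carrier])
qed

lemma mat_unit_mult_mat_unit:
  assumes "j < n" "k < n"
  shows "mat_unit n (Suc i) (Suc j) * mat_unit n (Suc k) (Suc l) =
    (if j = k then mat_unit n (Suc i) (Suc l) else 0\<^sub>m n n)"
  using assms
  by (intro eq_matI) (auto simp: index_mat_unit_mult[OF mat_unit_carrier] index_mat_unit)

section \<open>The reflection involution\<close>

lemma reflection_carrier: "reflection n A \<in> carrier_mat n n"
  by (simp add: reflection_def)

lemma reflection_index:
  "r < n \<Longrightarrow> c < n \<Longrightarrow> reflection n A $$ (r, c) = A $$ (n - 1 - c, n - 1 - r)"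
  by (simp add: reflection_def)

lemma reflection_UT: "A \<in> UT n \<Longrightarrow> reflection n A \<in> UT n"
  by (rule UT_I) (auto simp: reflection_carrier reflection_index UT_index_zero)

lemma reflection_reflection: "A \<in> carrier_mat n n \<Longrightarrow> reflection n (reflection n A) = A"
  by (rule eq_matI) (auto simp: reflection_def)

lemma reflection_mult:
  assumes "A \<in> carrier_mat n n" "B \<in> carrier_mat n n"
  shows "reflection n (A * B) = reflection n B * reflection n A"
proof (rule eq_matI)
  fix r c assume "r < dim_row (reflection n B * reflection n A)"
    "c < dim_col (reflection n B * reflection n A)"
  then have rc: "r < n" "c < n" by (auto simp: reflection_def)
  have "reflection n (A * B) $$ (r, c) = (\<Sum>s<n. A $$ (n - 1 - c, s) * B $$ (s, n - 1 - r))"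
    using rc assms by (simp add: reflection_index index_mult_mat_square)
  \<comment> \<open>Reversing the summation index moves both factors to reflected positions;
    commutativity of the field then swaps them.\<close>
  also have "\<dots> = (\<Sum>s<n. A $$ (n - 1 - c, n - Suc s) * B $$ (n - Suc s, n - 1 - r))"
    by (rule sum.nat_diff_reindex[symmetric])
  also have "\<dots> = (reflection n B * reflection n A) $$ (r, c)"
    using rc by (simp add: index_mult_mat_square[OF reflection_carrier reflection_carrier]
        reflection_index mult.commute)
  finally show "reflection n (A * B) $$ (r, c) = (reflection n B * reflection n A) $$ (r, c)" .
qed (auto simp: reflection_def)

lemma reflection_one: "reflection n (1\<^sub>m n) = 1\<^sub>m n"
  by (rule eq_matI) (auto simp: reflection_def)

section \<open>Inverses and the centre of \<open>UT n\<close>\<close>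

lemma UT_diag_nonzero:
  assumes "P \<in> UT n" "Q \<in> UT n" "Q * P = 1\<^sub>m n" "r < n"
  shows "Q $$ (r, r) \<noteq> 0" "P $$ (r, r) \<noteq> 0"
  using UT_index_diag_mult[OF assms(2,1,4)] assms(3,4) by auto

text \<open>Back substitution along row \<open>r\<close>: if \<open>R r c\<close> fails, then
  triangularity, transitivity and the induction hypothesis kill every term of
  \<open>(Q * P) $$ (r, c) = 0\<close> except \<open>Q $$ (r, c) * P $$ (c, c)\<close>. Taking
  \<open>R\<close> as the order gives triangular inverses; adding a degree condition gives
  homogeneous ones.\<close>

lemma inverse_support:
  assumes P: "P \<in> UT n" and Q: "Q \<in> carrier_mat n n" and QP: "Q * P = 1\<^sub>m n"
    and diag: "\<And>r. r < n \<Longrightarrow> P $$ (r, r) \<noteq> 0"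
    and refl: "\<And>r. R r r"
    and trans: "\<And>r s c. R r s \<Longrightarrow> R s c \<Longrightarrow> R r c"
    and supp: "\<And>r c. r < n \<Longrightarrow> c < n \<Longrightarrow> P $$ (r, c) \<noteq> 0 \<Longrightarrow> R r c"
  shows "r < n \<Longrightarrow> c < n \<Longrightarrow> Q $$ (r, c) \<noteq> 0 \<Longrightarrow> R r c"
proof (induction c rule: less_induct)
  case (less c)
  show ?case
  proof (rule ccontr)
    assume nR: "\<not> R r c"
    then have "r \<noteq> c" using refl by auto
    have "Q $$ (r, s) * P $$ (s, c) = (if s = c then Q $$ (r, c) * P $$ (c, c) else 0)"
      if "s < n" for s
    proof (cases s c rule: linorder_cases)
      case less
      then show ?thesis using less.IH[of s] less.prems nR trans[of r s c] supp[of s c] that by auto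
    next
      case greater
      then show ?thesis using UT_index_zero[OF P, of c s] that by simp
    qed simp
    then have "(\<Sum>s<n. Q $$ (r, s) * P $$ (s, c)) =
        (\<Sum>s<n. if s = c then Q $$ (r, c) * P $$ (c, c) else 0)"
      by (intro sum.cong) auto
    then have "(Q * P) $$ (r, c) = Q $$ (r, c) * P $$ (c, c)"
      using P Q less.prems by (simp add: index_mult_mat_square[of Q n] UT_carrier)
    then show False using QP less.prems \<open>r \<noteq> c\<close> diag[of c] by simp
  qed
qed

text \<open>The determinant is the product of the diagonal, which yields an inverse among all
  matrices; \<open>inverse_support\<close> with \<open>(\<le>)\<close> places it in
  \<open>UT n\<close>.\<close>

lemma UT_inverse_exists:
  assumes P: "P \<in> UT n" and diag: "\<And>r. r < n \<Longrightarrow> P $$ (r, r) \<noteq> 0"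
  obtains Q where "Q \<in> UT n" "P * Q = 1\<^sub>m n" "Q * P = 1\<^sub>m n"
proof -
  have Pc: "P \<in> carrier_mat n n" using P by (rule UT_carrier)
  have "upper_triangular P" using P by (simp add: UT_def)
  then have "det P = prod_list (diag_mat P)" using Pc by (rule det_upper_triangular)
  also have "\<dots> \<noteq> 0" using diag Pc by (auto simp: diag_mat_def)
  finally have "det P \<noteq> 0" .
  then obtain Q where Q: "Q \<in> carrier_mat n n" "P * Q = 1\<^sub>m n" "Q * P = 1\<^sub>m n"
    using det_non_zero_imp_unit[OF Pc, of "()"] unfolding Units_def
    by (auto simp: ring_mat_def)
  have "r \<le> c" if "r < n" "c < n" "Q $$ (r, c) \<noteq> 0" for r c
  proof (rule inverse_support[OF P Q(1,3) diag, of "(\<le>)" r c])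
    show "r \<le> c" if "P $$ (r, c) \<noteq> 0" "r < n" "c < n" for r c
      using UT_index_zero[OF P, of c r] that by (meson not_le)
  qed (use that in auto)
  then have "Q $$ (r, c) = 0" if "c < r" "r < n" for r c
    using that by (meson less_trans not_le)
  then have "Q \<in> UT n" using Q(1) by (intro UT_I) auto
  then show ?thesis using that Q by blast
qed

text \<open>Commuting with the units of the first row suffices: at \<open>(0, c)\<close> one product
  has the entry \<open>Z $$ (r, c)\<close>, the other has \<open>Z $$ (0, 0)\<close> if
  \<open>c = r\<close> and zero otherwise.\<close>

lemma UT_centre:
  assumes Z: "Z \<in> UT n" and com: "\<And>X. X \<in> UT n \<Longrightarrow> Z * X = X * Z" and n: "0 < n"
  shows "Z = Z $$ (0, 0) \<cdot>\<^sub>m 1\<^sub>m n"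
proof (rule eq_matI)
  fix r c assume "r < dim_row (Z $$ (0, 0) \<cdot>\<^sub>m 1\<^sub>m n)" "c < dim_col (Z $$ (0, 0) \<cdot>\<^sub>m 1\<^sub>m n)"
  then have rc: "r < n" "c < n" by auto
  note Zc = UT_carrier[OF Z]
  have "(mat_unit n 1 (Suc r) * Z) $$ (0, c) = (Z * mat_unit n 1 (Suc r)) $$ (0, c)"
    using com[OF mat_unit_UT, of 1 "Suc r"] by simp
  then have "Z $$ (r, c) = (if c = r then Z $$ (0, 0) else 0)"
    using rc n index_mat_unit_mult[OF Zc, of 0 c r 0] index_mult_mat_unit[OF Zc, of 0 c 0 r] by simp
  then show "Z $$ (r, c) = (Z $$ (0, 0) \<cdot>\<^sub>m 1\<^sub>m n) $$ (r, c)" using rc by simp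
qed (use UT_carrier[OF Z] in auto)

section \<open>Injective endomorphisms of \<open>UT n\<close> are inner\<close>

locale UT_monomorphism =
  fixes n :: nat and \<psi> :: "'k::field mat \<Rightarrow> 'k mat"
  assumes n_pos: "0 < n"
    and closed: "X \<in> UT n \<Longrightarrow> \<psi> X \<in> UT n"
    and add: "X \<in> UT n \<Longrightarrow> Y \<in> UT n \<Longrightarrow> \<psi> (X + Y) = \<psi> X + \<psi> Y"
    and smult: "X \<in> UT n \<Longrightarrow> \<psi> (a \<cdot>\<^sub>m X) = a \<cdot>\<^sub>m \<psi> X"
    and mult: "X \<in> UT n \<Longrightarrow> Y \<in> UT n \<Longrightarrow> \<psi> (X * Y) = \<psi> X * \<psi> Y"
    and kernel: "X \<in> UT n \<Longrightarrow> \<psi> X = 0\<^sub>m n n \<Longrightarrow> X = 0\<^sub>m n n"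
begin

lemma zero: "\<psi> (0\<^sub>m n n) = 0\<^sub>m n n"
proof -
  have z: "0\<^sub>m n n \<in> UT n" by (rule UT_I) auto
  have "\<psi> (0 \<cdot>\<^sub>m 0\<^sub>m n n) = 0 \<cdot>\<^sub>m \<psi> (0\<^sub>m n n)" by (rule smult[OF z])
  moreover have "(0::'k) \<cdot>\<^sub>m 0\<^sub>m n n = 0\<^sub>m n n" by auto
  moreover have "0 \<cdot>\<^sub>m \<psi> (0\<^sub>m n n) = 0\<^sub>m n n" using UT_carrier[OF closed[OF z]] by auto
  ultimately show ?thesis by simp
qed

text \<open>The unit at \<open>(i, i + 1)\<close> squares to zero, hence its image has zero diagonal, and
  multiplying \<open>d\<close> such images gives an element vanishing below the \<open>d\<close>-th superdiagonal.\<close>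

lemma index_zero_below_superdiagonal:
  "i + d < n \<Longrightarrow> r < n \<Longrightarrow> c < n \<Longrightarrow> c < r + d \<Longrightarrow> \<psi> (mat_unit n (Suc i) (Suc (i + d))) $$ (r, c) = 0"
proof (induction d arbitrary: r c)
  case 0
  then show ?case using UT_index_zero[OF closed[OF mat_unit_UT]] by simp
next
  case (Suc d)
  let ?A = "\<psi> (mat_unit n (Suc i) (Suc (i + d)))"
  let ?E = "mat_unit n (Suc (i + d)) (Suc (Suc (i + d))) :: 'k mat"
  have E: "?E \<in> UT n" and A: "?A \<in> UT n" by (auto intro!: mat_unit_UT closed)
  have "?E * ?E = 0\<^sub>m n n"
    using Suc.prems by (simp add: mat_unit_mult_mat_unit)
  then have "\<psi> ?E * \<psi> ?E = 0\<^sub>m n n" using mult[OF E E] zero by simp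
  then have diag: "\<psi> ?E $$ (s, s) = 0" if "s < n" for s
    using UT_index_diag_mult[OF closed[OF E] closed[OF E] that] that by simp
  have EE: "mat_unit n (Suc i) (Suc (i + Suc d)) = mat_unit n (Suc i) (Suc (i + d)) * ?E"
    using Suc.prems by (simp add: mat_unit_mult_mat_unit)
  \<comment> \<open>For \<open>s < r + d\<close> the induction hypothesis applies to the first
    factor; otherwise \<open>c \<le> r + d \<le> s\<close>, so the second factor is read on or below
    its zero diagonal.\<close>
  have "?A $$ (r, s) = 0 \<or> \<psi> ?E $$ (s, c) = 0" if "s < n" for s
  proof (cases "s < r + d")
    case True
    then show ?thesis using Suc that by simp
  next
    case False
    then have "c < s \<or> c = s" using Suc.prems by auto
    then show ?thesis using UT_index_zero[OF closed[OF E], of c s] diag that by auto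
  qed
  then have "(?A * \<psi> ?E) $$ (r, c) = 0"
    using A closed[OF E] Suc.prems by (intro index_mult_mat_eq_zero[of _ n]) (auto simp: UT_carrier)
  moreover have "\<psi> (mat_unit n (Suc i) (Suc (i + Suc d))) = ?A * \<psi> ?E"
    unfolding EE by (rule mult) (auto intro: mat_unit_UT)
  ultimately show ?case by simp
qed

text \<open>The first row of \<open>UT n\<close> is a right ideal on which \<open>X\<close> acts by right multiplication;
  reading off first rows of its image turns this action into an intertwining relation.\<close>

definition conjugator :: "'k mat" where
  "conjugator = mat n n (\<lambda>(r, c). \<psi> (mat_unit n 1 (Suc r)) $$ (0, c))"

lemma conjugator_carrier: "conjugator \<in> carrier_mat n n"
  by (simp add: conjugator_def)

lemma conjugator_index:
  "r < n \<Longrightarrow> c < n \<Longrightarrow> conjugator $$ (r, c) = \<psi> (mat_unit n 1 (Suc r)) $$ (0, c)"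
  by (simp add: conjugator_def)

text \<open>Linearity of \<open>\<psi>\<close>, one column at a time. The bound \<open>k\<close> is
  there for the induction; the case \<open>k = n\<close> evaluates the image of a matrix living in
  the first row.\<close>

lemma index_image_first_row:
  assumes "c < n" "k \<le> n"
  shows "\<psi> (mat n n (\<lambda>(r, s). if r = 0 \<and> s < k then x s else 0)) $$ (0, c) =
    (\<Sum>s<k. x s * conjugator $$ (s, c))"
  using assms(2)
proof (induction k)
  case 0
  have "mat n n (\<lambda>(r, s). if r = 0 \<and> s < 0 then x s else 0) = 0\<^sub>m n n" by auto
  then show ?case by (simp only: zero) (use assms n_pos in simp)
next
  case (Suc k)
  let ?M = "\<lambda>k. mat n n (\<lambda>(r, s). if r = 0 \<and> s < k then x s else 0)"
  let ?E = "mat_unit n 1 (Suc k) :: 'k mat"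
  have M: "?M j \<in> UT n" for j by (rule UT_I) auto
  have E: "?E \<in> UT n" by (rule mat_unit_UT) simp
  have "?M (Suc k) = ?M k + x k \<cdot>\<^sub>m ?E"
    by (rule eq_matI) (auto simp: mat_unit_def less_Suc_eq)
  then have "\<psi> (?M (Suc k)) = \<psi> (?M k) + x k \<cdot>\<^sub>m \<psi> ?E"
    using add[OF M UT_smult[OF E]] smult[OF E] by simp
  moreover have "(\<psi> (?M k) + x k \<cdot>\<^sub>m \<psi> ?E) $$ (0, c) = \<psi> (?M k) $$ (0, c) + x k * \<psi> ?E $$ (0, c)"
    using UT_carrier[OF closed[OF E]] n_pos assms by simp
  ultimately show ?case using Suc assms conjugator_index[of k c] by simp
qed

text \<open>Both entries at \<open>(r, c)\<close> equal the entry at \<open>(0, c)\<close> of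
  \<open>\<psi> (mat_unit n 1 (Suc r) * X)\<close>: multiplicativity gives the left side, and
  linearity the right side, because this product is row \<open>r\<close> of \<open>X\<close> moved
  to the top.\<close>

lemma conjugator_intertwines:
  assumes X: "X \<in> UT n"
  shows "conjugator * \<psi> X = X * conjugator"
proof (rule eq_matI)
  fix r c assume "r < dim_row (X * conjugator)" "c < dim_col (X * conjugator)"
  then have rc: "r < n" "c < n" using X conjugator_carrier by (auto simp: UT_def)
  let ?E = "mat_unit n 1 (Suc r) :: 'k mat"
  have E: "?E \<in> UT n" by (rule mat_unit_UT) simp
  have "(conjugator * \<psi> X) $$ (r, c) = (\<psi> ?E * \<psi> X) $$ (0, c)"
    using rc n_pos UT_carrier[OF closed[OF X]] UT_carrier[OF closed[OF E]] conjugator_carrier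
    by (simp add: index_mult_mat_square conjugator_index)
  also have "\<psi> ?E * \<psi> X = \<psi> (?E * X)" using mult[OF E X] by simp
  also have "?E * X = mat n n (\<lambda>(a, s). if a = 0 \<and> s < n then X $$ (r, s) else 0)"
    using rc index_mat_unit_mult[OF UT_carrier[OF X], of _ _ r 0] UT_carrier[OF X] E
    by (intro eq_matI) (auto simp: UT_def)
  also have "\<psi> \<dots> $$ (0, c) = (\<Sum>s<n. X $$ (r, s) * conjugator $$ (s, c))"
    by (rule index_image_first_row) (use rc in auto)
  also have "\<dots> = (X * conjugator) $$ (r, c)"
    using rc UT_carrier[OF X] conjugator_carrier by (simp add: index_mult_mat_square)
  finally show "(conjugator * \<psi> X) $$ (r, c) = (X * conjugator) $$ (r, c)" .
qed (use UT_carrier[OF X] UT_carrier[OF closed[OF X]] conjugator_carrier in auto)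

text \<open>Row \<open>r\<close> comes from a unit lying \<open>r\<close> places right of the
  diagonal, whose image has only zeros at \<open>(0, c)\<close> with \<open>c < r\<close>.\<close>

lemma conjugator_UT: "conjugator \<in> UT n"
proof (rule UT_I[OF conjugator_carrier])
  fix r c assume "c < r" "r < n"
  then show "conjugator $$ (r, c) = 0"
    using index_zero_below_superdiagonal[of 0 r 0 c] conjugator_index[of r c] by simp
qed

text \<open>The image of the corner unit is a nonzero multiple of the corner unit, and the corner
  entry of a factorisation through \<open>r\<close> has \<open>conjugator $$ (r, r)\<close> as a factor.\<close>

lemma conjugator_diag_nonzero:
  assumes r: "r < n"
  shows "conjugator $$ (r, r) \<noteq> 0"
proof
  assume z: "conjugator $$ (r, r) = 0"
  let ?C = "mat_unit n 1 n :: 'k mat"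
  let ?A = "mat_unit n 1 (Suc r) :: 'k mat" and ?B = "mat_unit n (Suc r) n :: 'k mat"
  have n: "n = Suc (n - 1)" using n_pos by simp
  have UTs: "?A \<in> UT n" "?B \<in> UT n" "?C \<in> UT n" using r by (auto intro!: mat_unit_UT)
  have "?C = ?A * ?B"
    using mat_unit_mult_mat_unit[of r n r 0 "n - 1", where 'a = 'k] r n by simp
  then have C: "\<psi> ?C = \<psi> ?A * \<psi> ?B" using mult UTs by simp
  \<comment> \<open>For \<open>s < r\<close> the first factor lies below the relevant superdiagonal
    of its matrix, and for \<open>s > r\<close> the second one does; at \<open>s = r\<close> the
    first is the entry assumed to vanish.\<close>
  have "\<psi> ?A $$ (0, s) = 0 \<or> \<psi> ?B $$ (s, n - 1) = 0" if "s < n" for s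
  proof (cases s r rule: linorder_cases)
    case less
    then show ?thesis using index_zero_below_superdiagonal[of 0 r 0 s] r that by simp
  next
    case equal
    then show ?thesis using z conjugator_index[OF r r] by simp
  next
    case greater
    then show ?thesis
      using index_zero_below_superdiagonal[of r "n - 1 - r" s "n - 1"] r that n by simp
  qed
  then have corner: "\<psi> ?C $$ (0, n - 1) = 0"
    using n_pos UT_carrier[OF closed[OF UTs(1)]] UT_carrier[OF closed[OF UTs(2)]]
    unfolding C by (intro index_mult_mat_eq_zero[of _ n]) auto
  \<comment> \<open>Every position but the corner lies below superdiagonal
    \<open>n - 1\<close>.\<close>
  have "\<psi> ?C $$ (a, b) = 0" if "a < n" "b < n" for a b
  proof (cases "a = 0 \<and> b = n - 1")
    case False
    then have "b < a + (n - 1)" using that by auto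
    then show ?thesis using index_zero_below_superdiagonal[of 0 "n - 1" a b] that n by simp
  qed (use corner in auto)
  then have "\<psi> ?C = 0\<^sub>m n n" using UT_carrier[OF closed[OF UTs(3)]] by auto
  then have "?C = 0\<^sub>m n n" by (rule kernel[OF UTs(3)])
  then have "?C $$ (0, n - 1) = 0" using n_pos by simp
  then show False using n_pos by (simp add: mat_unit_def)
qed

text \<open>The inverse of the conjugator, applied on the left of the intertwining relation,
  exhibits \<open>\<psi>\<close> as a conjugation.\<close>

lemma inner:
  obtains Q where "Q \<in> UT n" "conjugator * Q = 1\<^sub>m n" "Q * conjugator = 1\<^sub>m n"
    "\<And>X. X \<in> UT n \<Longrightarrow> \<psi> X = Q * X * conjugator"
proof -
  obtain Q where Q: "Q \<in> UT n" "conjugator * Q = 1\<^sub>m n" "Q * conjugator = 1\<^sub>m n"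
    using UT_inverse_exists[OF conjugator_UT conjugator_diag_nonzero] .
  have "\<psi> X = Q * X * conjugator" if X: "X \<in> UT n" for X
  proof -
    note car = UT_carrier[OF X] UT_carrier[OF closed[OF X]] UT_carrier[OF Q(1)] conjugator_carrier
    have "\<psi> X = Q * conjugator * \<psi> X" using car Q by simp
    also have "\<dots> = Q * (X * conjugator)"
      using conjugator_intertwines[OF X] assoc_mult_mat[OF car(3,4,2)] by simp
    also have "\<dots> = Q * X * conjugator" using assoc_mult_mat[OF car(3,1,4)] by simp
    finally show ?thesis .
  qed
  then show ?thesis using that Q by blast
qed

end

section \<open>From an involution to a symmetric or skew matrix\<close>

text \<open>Composing two anti-multiplicative maps gives a multiplicative one; its kernel is trivial
  because both are their own inverses.\<close>

lemma UT_involution_reflection_monomorphism: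
  assumes \<phi>: "UT_involution n \<phi>" and n: "0 < n"
  shows "UT_monomorphism n (\<lambda>X. \<phi> (reflection n X))"
proof
  have inv: "\<phi> X \<in> UT n" "\<phi> (\<phi> X) = X" "\<phi> (a \<cdot>\<^sub>m X) = a \<cdot>\<^sub>m \<phi> X" if "X \<in> UT n" for X a
    using \<phi> that by (auto simp: UT_involution_def)
  fix X Y :: "'a mat" and a :: 'a
  assume X: "X \<in> UT n"
  note Xc = UT_carrier[OF X] and RX = reflection_UT[OF X]
  show "\<phi> (reflection n X) \<in> UT n" using inv RX by blast
  show "\<phi> (reflection n (a \<cdot>\<^sub>m X)) = a \<cdot>\<^sub>m \<phi> (reflection n X)"
    using inv(3)[OF RX] reflection_linear(2)[OF Xc Xc] by simp
  show "X = 0\<^sub>m n n" if "\<phi> (reflection n X) = 0\<^sub>m n n"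
  proof -
    have z: "0\<^sub>m n n \<in> UT n" by (rule UT_I) auto
    have "0 \<cdot>\<^sub>m A = 0\<^sub>m n n" if "A \<in> UT n" for A :: "'a mat" using UT_carrier[OF that] by auto
    then have "\<phi> (0\<^sub>m n n) = 0\<^sub>m n n" using inv(3)[OF z, of 0] inv(1)[OF z] z by simp
    then have "reflection n X = 0\<^sub>m n n" using inv(2)[OF RX] that by simp
    then have "reflection n (0\<^sub>m n n) = X" using reflection_reflection[OF Xc] by simp
    moreover have "reflection n (0\<^sub>m n n) = (0\<^sub>m n n :: 'a mat)" by (auto simp: reflection_def)
    ultimately show ?thesis by simp
  qed
  assume Y: "Y \<in> UT n"
  note Yc = UT_carrier[OF Y] and RY = reflection_UT[OF Y]
  show "\<phi> (reflection n (X + Y)) = \<phi> (reflection n X) + \<phi> (reflection n Y)"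
    using \<phi> RX RY reflection_linear(1)[OF Xc Yc] by (simp add: UT_involution_def)
  show "\<phi> (reflection n (X * Y)) = \<phi> (reflection n X) * \<phi> (reflection n Y)"
    using \<phi> RX RY reflection_mult[OF Xc Yc] by (simp add: UT_involution_def)
qed (rule n)

lemma involution_conjugator_symmetric:
  fixes \<phi> :: "'k::field mat \<Rightarrow> 'k mat"
  assumes inv: "UT_involution n \<phi>" and n: "0 < n"
    and P: "P \<in> UT n" and Q: "Q \<in> UT n" and PQ: "P * Q = 1\<^sub>m n" and QP: "Q * P = 1\<^sub>m n"
    and \<phi>: "\<And>X. X \<in> UT n \<Longrightarrow> \<phi> X = Q * reflection n X * P"
  shows "reflection n P = P \<or> even n \<and> reflection n P = - P"
proof -
  let ?r = "reflection n"
  note Pc = UT_carrier[OF P] and Qc = UT_carrier[OF Q] and rc = reflection_carrier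
  have rPQ: "?r Q * ?r P = 1\<^sub>m n" and rQP: "?r P * ?r Q = 1\<^sub>m n"
    using PQ QP reflection_mult[OF Pc Qc] reflection_mult[OF Qc Pc] reflection_one by metis+
  have assoc: "A * B * C = A * (B * C)" 
    if "A \<in> carrier_mat n n" "B \<in> carrier_mat n n" "C \<in> carrier_mat n n" for A B C :: "'k mat"
    using that by (rule assoc_mult_mat)
  have car: "A * B \<in> carrier_mat n n" if "A \<in> carrier_mat n n" "B \<in> carrier_mat n n"
    for A B :: "'k mat"
    using that by simp
  have cancel: "P * (Q * Z) = Z" if "Z \<in> carrier_mat n n" for Z
    using that Pc Qc by (simp add: assoc[symmetric] PQ)
  have com: "Q * ?r P * X = X * (Q * ?r P)" if X: "X \<in> UT n" for X
  proof -
    note Xc = UT_carrier[OF X]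
    have RX: "?r X \<in> UT n" using X by (rule reflection_UT)
    have "X = \<phi> (\<phi> X)" using inv X by (simp add: UT_involution_def)
    also have "\<dots> = Q * ?r (Q * ?r X * P) * P"
      using \<phi>[OF X] \<phi>[OF UT_mult[OF UT_mult[OF Q RX] P]] by simp
    also have "?r (Q * ?r X * P) = ?r P * (X * ?r Q)"
      using reflection_mult[OF mult_carrier_mat[OF Qc rc] Pc] reflection_mult[OF Qc rc]
        reflection_reflection[OF Xc] by simp
    finally have "X * (Q * ?r P) = Q * (?r P * (X * ?r Q)) * P * (Q * ?r P)" by simp
    \<comment> \<open>With everything associated to the right, \<open>P * Q\<close> and then
      \<open>?r Q * ?r P\<close> collapse to the identity.\<close>
    also have "\<dots> = Q * ?r P * X"
      using Xc by (simp only: assoc car cancel rPQ Pc Qc rc right_mult_one_mat[of _ n n])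
    finally show ?thesis by simp
  qed
  define a where "a = (Q * ?r P) $$ (0, 0)"
  have "Q * ?r P = a \<cdot>\<^sub>m 1\<^sub>m n"
    unfolding a_def by (rule UT_centre[OF UT_mult[OF Q reflection_UT[OF P]] com n])
  then have "P * (Q * ?r P) = P * (a \<cdot>\<^sub>m 1\<^sub>m n)" by simp
  moreover have "P * (Q * ?r P) = ?r P"
    using assoc_mult_mat[OF Pc Qc rc, symmetric] PQ rc by (simp add: left_mult_one_mat[OF rc])
  moreover have "P * (a \<cdot>\<^sub>m 1\<^sub>m n) = a \<cdot>\<^sub>m P"
    using mult_smult_distrib[OF Pc one_carrier_mat] Pc by simp
  ultimately have rP: "?r P = a \<cdot>\<^sub>m P" by simp
  have diag: "P $$ (r, r) \<noteq> 0" if "r < n" for r using UT_diag_nonzero(2)[OF P Q QP that] .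
  have ref: "P $$ (n - 1 - r, n - 1 - r) = a * P $$ (r, r)" if "r < n" for r
    using arg_cong[OF rP, of "\<lambda>M. M $$ (r, r)"] that Pc by (simp add: reflection_index)
  \<comment> \<open>The reflection exchanges the two ends of the diagonal, so using
    \<open>ref\<close> at both gives \<open>a * a = 1\<close>.\<close>
  have "P $$ (0, 0) = a * (a * P $$ (0, 0))"
    using ref[of 0] ref[of "n - 1"] n by simp
  then have "(a - 1) * (a + 1) = 0" using diag[OF n] by (simp add: algebra_simps)
  then have "a = 1 \<or> a = - 1" by (auto simp: eq_neg_iff_add_eq_0)
  moreover have "a = 1" if "odd n"
  proof -
    \<comment> \<open>The index \<open>m\<close> is the middle of the diagonal, where
      \<open>n - 1 - m = m\<close>.\<close>
    obtain m where "n = 2 * m + 1" using \<open>odd n\<close> by (rule oddE)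
    then show ?thesis using ref[of m] diag[of m] by simp
  qed
  moreover have "1 \<cdot>\<^sub>m P = P" "(- 1) \<cdot>\<^sub>m P = - P" by (auto intro: eq_matI)
  ultimately show ?thesis using rP by metis
qed

section \<open>Degrees of positions in the elementary grading\<close>

locale elementary_UT = group G for G (structure) +
  fixes n :: nat and g :: "nat \<Rightarrow> 'a"
  assumes g_closed: "i \<in> {1..n - 1} \<Longrightarrow> g i \<in> carrier G"
begin

lemma seg_prod_0 [simp]: "seg_prod G g i 0 = \<one>"
  by (simp add: seg_prod_def)

lemma seg_prod_Suc: "seg_prod G g i (Suc k) = g i \<otimes> seg_prod G g (Suc i) k"
  by (simp add: seg_prod_def upt_conv_Cons del: upt_Suc)

lemma seg_prod_closed: "1 \<le> i \<Longrightarrow> i + k \<le> n \<Longrightarrow> seg_prod G g i k \<in> carrier G"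
  by (induction k arbitrary: i) (auto simp: seg_prod_Suc g_closed)

lemma seg_prod_add:
  "1 \<le> i \<Longrightarrow> i + k + l \<le> n \<Longrightarrow> seg_prod G g i (k + l) = seg_prod G g i k \<otimes> seg_prod G g (i + k) l"
proof (induction k arbitrary: i)
  case 0
  then show ?case using seg_prod_closed[of i l] by simp
next
  case (Suc k)
  then show ?case
    using m_assoc[OF g_closed seg_prod_closed seg_prod_closed, of i "Suc i" k "Suc (i + k)" l]
    by (simp add: seg_prod_Suc)
qed

text \<open>Degree of the matrix unit sitting at entry \<open>(r, c)\<close>; \<open>r + 1\<close>
  converts back to the numbering of \<open>g\<close> from 1.\<close>

definition deg :: "nat \<Rightarrow> nat \<Rightarrow> 'a" where
  "deg r c = seg_prod G g (r + 1) (c - r)"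

lemma deg_closed: "r \<le> c \<Longrightarrow> c < n \<Longrightarrow> deg r c \<in> carrier G"
  unfolding deg_def by (rule seg_prod_closed) auto

lemma deg_refl [simp]: "deg r r = \<one>"
  by (simp add: deg_def)

lemma deg_mult: "r \<le> s \<Longrightarrow> s \<le> c \<Longrightarrow> c < n \<Longrightarrow> deg r s \<otimes> deg s c = deg r c"
  using seg_prod_add[of "r + 1" "s - r" "c - s"] by (simp add: deg_def)

abbreviation "grade \<equiv> elementary_grading G n g"

lemma grade_iff:
  "A \<in> grade h \<longleftrightarrow> A \<in> UT n \<and> (\<forall>r c. r \<le> c \<longrightarrow> c < n \<longrightarrow> A $$ (r, c) \<noteq> 0 \<longrightarrow> deg r c = h)"
  by (simp add: elementary_grading_iff deg_def)

lemma grade_UT: "A \<in> grade h \<Longrightarrow> A \<in> UT n"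
  by (simp add: grade_iff)

lemma grade_deg: "A \<in> grade h \<Longrightarrow> r < n \<Longrightarrow> c < n \<Longrightarrow> A $$ (r, c) \<noteq> 0 \<Longrightarrow> r \<le> c \<and> deg r c = h"
  using UT_index_zero[of A n c r] by (cases "c < r") (auto simp: grade_iff)

lemma grade_mult: "A \<in> grade h \<Longrightarrow> B \<in> grade k \<Longrightarrow> A * B \<in> grade (h \<otimes> k)"
  unfolding grade_iff[of "A * B"]
proof (intro conjI allI impI)
  fix r c assume AB: "A \<in> grade h" "B \<in> grade k" and rc: "r \<le> c" "c < n" and nz: "(A * B) $$ (r, c) \<noteq> 0"
  \<comment> \<open>A nonzero entry of the product has a nonzero summand; degrees multiply along the
    path from \<open>r\<close> through \<open>s\<close> to \<open>c\<close>.\<close>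
  then obtain s where s: "s < n" "A $$ (r, s) \<noteq> 0" "B $$ (s, c) \<noteq> 0"
    using index_mult_mat_eq_zero[OF UT_carrier[OF grade_UT] UT_carrier[OF grade_UT], of A h B k r c]
    by (meson le_less_trans)
  then show "deg r c = h \<otimes> k"
    using grade_deg[OF AB(1), of r s] grade_deg[OF AB(2), of s c] deg_mult[of r s c] rc by auto
qed (auto intro: UT_mult grade_UT)

lemma mat_unit_grade: "r \<le> c \<Longrightarrow> mat_unit n (Suc r) (Suc c) \<in> grade (deg r c)"
  by (auto simp: grade_iff mat_unit_UT index_mat_unit)

lemma grading_supp_iff:
  "h \<in> grading_supp G n (grade :: 'a \<Rightarrow> 'k::field mat set) \<longleftrightarrow> (\<exists>r c. r \<le> c \<and> c < n \<and> deg r c = h)"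
proof
  assume h: "h \<in> grading_supp G n (grade :: 'a \<Rightarrow> 'k mat set)"
  have "0\<^sub>m n n \<in> (grade h :: 'k mat set)" by (auto simp: grade_iff intro!: UT_I)
  then obtain A :: "'k mat" where A: "A \<in> grade h" "A \<noteq> 0\<^sub>m n n"
    using h by (auto simp: grading_supp_def)
  note UT_carrier[OF grade_UT[OF A(1)]]
  then obtain r c where "r < n" "c < n" "A $$ (r, c) \<noteq> 0"
    using A(2) eq_matI[of A "0\<^sub>m n n"] by auto
  then show "\<exists>r c. r \<le> c \<and> c < n \<and> deg r c = h" using grade_deg[OF A(1)] by blast
next
  assume "\<exists>r c. r \<le> c \<and> c < n \<and> deg r c = h"
  then obtain r c where rc: "r \<le> c" "c < n" "deg r c = h" by blast
  let ?E = "mat_unit n (Suc r) (Suc c) :: 'k mat"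
  have "?E $$ (r, c) \<noteq> 0\<^sub>m n n $$ (r, c)" using rc by (simp add: index_mat_unit)
  then have "?E \<noteq> 0\<^sub>m n n" by auto
  then show "h \<in> grading_supp G n (grade :: 'a \<Rightarrow> 'k mat set)"
    using mat_unit_grade[OF rc(1)] rc deg_closed by (auto simp: grading_supp_def)
qed

section \<open>Condition (1) in terms of positions\<close>

definition reflective :: bool where
  "reflective \<longleftrightarrow> (\<forall>r c r' c'. r < c \<longrightarrow> c < n \<longrightarrow> r' < c' \<longrightarrow> c' < n \<longrightarrow> deg r c = deg r' c' \<longrightarrow>
     deg (n - 1 - c) (n - 1 - r) = deg (n - 1 - c') (n - 1 - r'))"

text \<open>The dictionary is \<open>i = r + 1\<close> and \<open>k = c - r\<close>; the reflected
  segment then starts at \<open>n - i - k + 1 = n - c\<close> and keeps its length.\<close>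

lemma reflective_iff:
  "reflective \<longleftrightarrow> (\<forall>i\<in>{1..n - 1}. \<forall>j\<in>{1..n - 1}. \<forall>k\<in>{1..n - i}. \<forall>l\<in>{1..n - j}.
       seg_prod G g i k = seg_prod G g j l \<longrightarrow>
       seg_prod G g (n - i - k + 1) k = seg_prod G g (n - j - l + 1) l)" (is "_ \<longleftrightarrow> ?R")
proof -
  have *: "deg (n - 1 - c) (n - 1 - r) = seg_prod G g (n - c) (c - r)" if "r < c" "c < n" for r c
    using that by (simp add: deg_def) (metis Suc_diff_Suc)
  show ?thesis
  proof
    assume refl: reflective
    show ?R
    proof (intro ballI impI)
      fix i j k l assume i: "i \<in> {1..n - 1}" and j: "j \<in> {1..n - 1}" and k: "k \<in> {1..n - i}"
        and l: "l \<in> {1..n - j}" and eq: "seg_prod G g i k = seg_prod G g j l"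
      have deg: "deg (i - 1) (i - 1 + k) = deg (j - 1) (j - 1 + l)"
        using i j eq by (simp add: deg_def)
      have ik: "i - 1 < i - 1 + k" "i - 1 + k < n" "j - 1 < j - 1 + l" "j - 1 + l < n"
        using i j k l by auto
      have "n - (i - 1 + k) = n - i - k + 1" "n - (j - 1 + l) = n - j - l + 1"
        using i j k l by auto
      then show "seg_prod G g (n - i - k + 1) k = seg_prod G g (n - j - l + 1) l"
        using refl[unfolded reflective_def, rule_format, OF ik deg] *[OF ik(1,2)] *[OF ik(3,4)]
        by (simp only: add_diff_cancel_left')
    qed
  next
    assume R: ?R
    show reflective
      unfolding reflective_def
    proof (intro allI impI)
      fix r c r' c' assume rc: "r < c" "c < n" "r' < c'" "c' < n" "deg r c = deg r' c'"
      have "n - (r + 1) - (c - r) + 1 = n - c" "n - (r' + 1) - (c' - r') + 1 = n - c'"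
        using rc by auto
      moreover have "r + 1 \<in> {1..n - 1}" "r' + 1 \<in> {1..n - 1}"
        "c - r \<in> {1..n - (r + 1)}" "c' - r' \<in> {1..n - (r' + 1)}" using rc by auto
      ultimately have "seg_prod G g (n - c) (c - r) = seg_prod G g (n - c') (c' - r')"
        using R rc(5) unfolding deg_def by metis
      then show "deg (n - 1 - c) (n - 1 - r) = deg (n - 1 - c') (n - 1 - r')"
        using *[OF rc(1,2)] *[OF rc(3,4)] by simp
    qed
  qed
qed

text \<open>Condition (1) says nothing about empty products; the missing case follows by cancelling a
  generator adjacent to the segment, and the full segment is its own reflection.\<close>

lemma reflective_one:
  assumes refl: reflective and rc: "r \<le> c" "c < n" and e: "deg r c = \<one>"
  shows "deg (n - 1 - c) (n - 1 - r) = \<one>"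
proof (cases "r = c")
  case False
  then have lt: "r < c" using rc by simp
  let ?c = "n - 1 - c" and ?r = "n - 1 - r"
  consider "r = 0" "c = n - 1" | "0 < r" | "c < n - 1" using rc by linarith
  then show ?thesis
  proof cases
    case 1
    then show ?thesis using e by simp
  next
    case 2
    let ?u = "n - 1 - (r - 1)"
    \<comment> \<open>\<open>(r, c)\<close> and the empty segment \<open>(r, r)\<close>, both
      prolonged to the left by one generator, have the same degree and fall under (1).\<close>
    have "deg (r - 1) c = deg (r - 1) r"
      using deg_mult[of "r - 1" r c] deg_closed[of "r - 1" r] rc e by simp
    then have "deg ?c ?u = deg ?r ?u"
      using refl[unfolded reflective_def, rule_format, of "r - 1" c "r - 1" r] 2 lt rc by simp
    moreover have "deg ?c ?r \<otimes> deg ?r ?u = deg ?c ?u"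
      using 2 lt rc by (intro deg_mult) auto
    moreover have "deg ?c ?r \<in> carrier G" "deg ?r ?u \<in> carrier G"
      using 2 lt rc by (auto intro!: deg_closed)
    ultimately show ?thesis using r_cancel_one by simp
  next
    case 3
    let ?u = "n - 1 - (c + 1)"
    have "deg r (c + 1) = deg c (c + 1)"
      using deg_mult[of r c "c + 1"] deg_closed[of c "c + 1"] rc 3 e by simp
    then have "deg ?u ?r = deg ?u ?c"
      using refl[unfolded reflective_def, rule_format, of r "c + 1" c "c + 1"] 3 lt rc by simp
    moreover have "deg ?u ?c \<otimes> deg ?c ?r = deg ?u ?r"
      using 3 lt rc by (intro deg_mult) auto
    moreover have "deg ?u ?c \<in> carrier G" "deg ?c ?r \<in> carrier G"
      using 3 lt rc by (auto intro!: deg_closed)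
    ultimately show ?thesis using l_cancel_one by simp
  qed
qed simp

text \<open>Diagonal units may share the neutral degree with units off the diagonal, so a map on
  degrees requires this version. If either position is diagonal, both degrees are neutral and
  \<open>reflective_one\<close> applies.\<close>

lemma reflective_weak:
  assumes refl: reflective and rc: "r \<le> c" "c < n" "r' \<le> c'" "c' < n" and e: "deg r c = deg r' c'"
  shows "deg (n - 1 - c) (n - 1 - r) = deg (n - 1 - c') (n - 1 - r')"
proof (cases "r = c \<or> r' = c'")
  case True
  then have "deg r c = \<one>" "deg r' c' = \<one>" using e by auto
  then show ?thesis using reflective_one[OF refl] rc by simp
next
  case False
  then show ?thesis using refl[unfolded reflective_def] rc e by (meson le_neq_implies_less)
qed

section \<open>Homogeneity of the involution\<close>

lemma grade_inverse:
  assumes P: "P \<in> grade \<one>" and Q: "Q \<in> UT n" and PQ: "P * Q = 1\<^sub>m n" and QP: "Q * P = 1\<^sub>m n"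
  shows "Q \<in> grade \<one>"
proof -
  \<comment> \<open>Reflexive, and transitive by \<open>deg_mult\<close>. The guard
    \<open>c < n\<close> is there because \<open>inverse_support\<close> asks for transitivity at
    all indices.\<close>
  let ?R = "\<lambda>r c. r \<le> c \<and> (c < n \<longrightarrow> deg r c = \<one>)"
  have "?R r c" if "r < n" "c < n" "Q $$ (r, c) \<noteq> 0" for r c
  proof (rule inverse_support[OF grade_UT[OF P] UT_carrier[OF Q] QP, of ?R r c])
    show "P $$ (r, r) \<noteq> 0" if "r < n" for r
      using UT_diag_nonzero(2)[OF grade_UT[OF P] Q QP that] .
    show "?R r c" if "?R r s" "?R s c" for r s c
      using that deg_mult[of r s c] by auto
  qed (use that grade_deg[OF P] in auto)
  then show ?thesis using Q by (auto simp: grade_iff)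
qed

text \<open>Under \<open>reflective\<close> the reflection induces a map \<open>\<theta>\<close> on
  degrees, and multiplying by \<open>Q\<close> and \<open>P\<close>, both of degree
  \<open>\<one>\<close>, changes no degree.\<close>

lemma homogeneous_if_reflective:
  fixes \<phi> :: "'k::field mat \<Rightarrow> 'k mat"
  assumes inv: "UT_involution n \<phi>" and refl: reflective
    and P: "P \<in> grade \<one>" and Q: "Q \<in> UT n" and PQ: "P * Q = 1\<^sub>m n" and QP: "Q * P = 1\<^sub>m n"
    and \<phi>: "\<And>X. X \<in> UT n \<Longrightarrow> \<phi> X = Q * reflection n X * P"
  shows "homogeneous_map G n grade \<phi>"
proof -
  let ?S = "grading_supp G n (grade :: 'a \<Rightarrow> 'k mat set)"
  have "\<exists>k. \<forall>r c. r \<le> c \<longrightarrow> c < n \<longrightarrow> deg r c = h \<longrightarrow> deg (n - 1 - c) (n - 1 - r) = k"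
    if h: "h \<in> ?S" for h
  proof -
    obtain r c where "r \<le> c" "c < n" "deg r c = h" using h unfolding grading_supp_iff by blast
    then show ?thesis
      by (intro exI[of _ "deg (n - 1 - c) (n - 1 - r)"] allI impI) (rule reflective_weak[OF refl], auto)
  qed
  then obtain \<theta> where *: "\<forall>h\<in>?S. \<forall>r c. r \<le> c \<longrightarrow> c < n \<longrightarrow> deg r c = h \<longrightarrow>
      deg (n - 1 - c) (n - 1 - r) = \<theta> h"
    using bchoice[of ?S "\<lambda>h k. \<forall>r c. r \<le> c \<longrightarrow> c < n \<longrightarrow> deg r c = h \<longrightarrow>
        deg (n - 1 - c) (n - 1 - r) = k"] by auto
  have \<theta>: "deg (n - 1 - c) (n - 1 - r) = \<theta> (deg r c)" if "r \<le> c" "c < n" for r c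
  proof -
    have "deg r c \<in> ?S" unfolding grading_supp_iff using that by blast
    then show ?thesis using * that by blast
  qed
  \<comment> \<open>\<open>\<theta>\<close> is its own inverse, as reflecting a position twice
    restores it.\<close>
  have \<theta>S: "\<theta> h \<in> ?S" and \<theta>\<theta>: "\<theta> (\<theta> h) = h" if h: "h \<in> ?S" for h
  proof -
    obtain r c where rc: "r \<le> c" "c < n" "deg r c = h" using h unfolding grading_supp_iff by blast
    then have *: "n - 1 - c \<le> n - 1 - r" "n - 1 - r < n" "deg (n - 1 - c) (n - 1 - r) = \<theta> h"
      using \<theta> by auto
    then show "\<theta> h \<in> ?S" unfolding grading_supp_iff by blast
    show "\<theta> (\<theta> h) = h" using \<theta>[OF *(1,2)] * rc by simp
  qed
  have Qe: "Q \<in> grade \<one>" using grade_inverse[OF P Q PQ QP] .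
  have sub: "\<phi> X \<in> grade (\<theta> h)" if h: "h \<in> ?S" and X: "X \<in> grade h" for h X
  proof -
    have "deg r c = \<theta> h" if "r \<le> c" "c < n" "reflection n X $$ (r, c) \<noteq> 0" for r c
    proof -
      have "X $$ (n - 1 - c, n - 1 - r) \<noteq> 0" using that by (simp add: reflection_index)
      then have "deg (n - 1 - c) (n - 1 - r) = h" using grade_deg[OF X] that by simp
      then show ?thesis using \<theta>[of "n - 1 - c" "n - 1 - r"] that by simp
    qed
    then have "reflection n X \<in> grade (\<theta> h)"
      using reflection_UT[OF grade_UT[OF X]] by (simp add: grade_iff)
    then have "Q * reflection n X * P \<in> grade (\<one> \<otimes> \<theta> h \<otimes> \<one>)"
      using grade_mult Qe P by blast
    moreover have "\<theta> h \<in> carrier G" using \<theta>S[OF h] by (simp add: grading_supp_def)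
    ultimately show ?thesis using \<phi>[OF grade_UT[OF X]] by simp
  qed
  have "bij_betw \<theta> ?S ?S"
    by (rule bij_betw_byWitness[of _ \<theta>]) (use \<theta>S \<theta>\<theta> in auto)
  moreover have "\<phi> ` grade h = grade (\<theta> h)" if h: "h \<in> ?S" for h
  proof
    show "\<phi> ` grade h \<subseteq> grade (\<theta> h)" using sub[OF h] by blast
    show "grade (\<theta> h) \<subseteq> \<phi> ` grade h"
    proof
      fix Y :: "'k mat" assume Y: "Y \<in> grade (\<theta> h)"
      then have "\<phi> Y \<in> grade h" using sub[OF \<theta>S[OF h] Y] \<theta>\<theta>[OF h] by simp
      moreover have "\<phi> (\<phi> Y) = Y" using inv grade_UT[OF Y] by (simp add: UT_involution_def)
      ultimately show "Y \<in> \<phi> ` grade h" by (metis imageI)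
    qed
  qed
  ultimately show ?thesis unfolding homogeneous_map_def theta_homogeneous_def by blast
qed

text \<open>At the reflected position, the image of the unit at \<open>(r, c)\<close> has a product
  of diagonal entries of \<open>Q\<close> and \<open>P\<close>, hence a nonzero entry. So the degree
  there is \<open>\<theta> (deg r c)\<close>, which depends on \<open>deg r c\<close> alone.\<close>

lemma reflective_if_homogeneous:
  fixes \<phi> :: "'k::field mat \<Rightarrow> 'k mat"
  assumes P: "P \<in> UT n" and Q: "Q \<in> UT n" and QP: "Q * P = 1\<^sub>m n"
    and \<phi>: "\<And>X. X \<in> UT n \<Longrightarrow> \<phi> X = Q * reflection n X * P"
    and \<theta>: "theta_homogeneous G n grade \<theta> \<phi>"
  shows reflective
proof -
  have "deg (n - 1 - c) (n - 1 - r) = \<theta> (deg r c)" if rc: "r < c" "c < n" for r c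
  proof -
    let ?E = "mat_unit n (Suc r) (Suc c) :: 'k mat"
    let ?c = "n - 1 - c" and ?r = "n - 1 - r"
    have E: "?E \<in> grade (deg r c)" using mat_unit_grade[of r c] rc by simp
    have "deg r c \<in> grading_supp G n (grade :: 'a \<Rightarrow> 'k mat set)"
      unfolding grading_supp_iff using rc by (intro exI[of _ r] exI[of _ c]) simp
    then have "\<phi> ?E \<in> grade (\<theta> (deg r c))" using \<theta> E by (auto simp: theta_homogeneous_def)
    moreover have "\<phi> ?E $$ (?c, ?r) \<noteq> 0"
    proof -
      have "reflection n ?E = mat_unit n (Suc ?c) (Suc ?r)"
        using rc reflection_mat_unit[of "Suc r" "Suc c" n, where 'a = 'k] by simp
      then have "\<phi> ?E = Q * mat_unit n (Suc ?c) (Suc ?r) * P" using \<phi>[OF grade_UT[OF E]] by simp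
      moreover have "Q * mat_unit n (Suc ?c) (Suc ?r) * P = Q * (mat_unit n (Suc ?c) (Suc ?r) * P)"
        using assoc_mult_mat[OF UT_carrier[OF Q] mat_unit_carrier UT_carrier[OF P]] .
      moreover have "(Q * (mat_unit n (Suc ?c) (Suc ?r) * P)) $$ (?c, ?r) = 
          Q $$ (?c, ?c) * P $$ (?r, ?r)"
      proof -
        have EP: "mat_unit n (Suc ?c) (Suc ?r) * P \<in> carrier_mat n n"
          by (rule mult_carrier_mat[OF mat_unit_carrier UT_carrier[OF P]])
        have "Q $$ (?c, s) * (mat_unit n (Suc ?c) (Suc ?r) * P) $$ (s, ?r) =
            (if s = ?c then Q $$ (?c, ?c) * P $$ (?r, ?r) else 0)" if "s < n" for s
          using index_mat_unit_mult[OF UT_carrier[OF P] that] rc by simp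
        then have "(\<Sum>s<n. Q $$ (?c, s) * (mat_unit n (Suc ?c) (Suc ?r) * P) $$ (s, ?r)) =
            (\<Sum>s<n. if s = ?c then Q $$ (?c, ?c) * P $$ (?r, ?r) else 0)"
          by (intro sum.cong) auto
        moreover have "?c < n" "?r < n" using rc by auto
        ultimately show ?thesis
          using index_mult_mat_square[OF UT_carrier[OF Q] EP, of ?c ?r] by simp
      qed
      moreover have "Q $$ (?c, ?c) \<noteq> 0" "P $$ (?r, ?r) \<noteq> 0"
        using UT_diag_nonzero[OF P Q QP] rc by auto
      ultimately show ?thesis by simp
    qed
    ultimately show ?thesis
      using grade_deg[of "\<phi> ?E" "\<theta> (deg r c)" ?c ?r] rc by simp
  qed
  then show ?thesis unfolding reflective_def by simp
qed

lemma conjugator_grade_one: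
  fixes \<phi> :: "'k::field mat \<Rightarrow> 'k mat"
  assumes "UT_involution n \<phi>" "0 < n"
    and \<theta>: "theta_homogeneous G n grade \<theta> \<phi>"
  shows "UT_monomorphism.conjugator n (\<lambda>X. \<phi> (reflection n X)) \<in> grade \<one>"
proof -
  interpret UT_monomorphism n "\<lambda>X. \<phi> (reflection n X)"
    by (rule UT_involution_reflection_monomorphism) fact+
  have "deg r c = \<one>" if rc: "r \<le> c" "c < n" "conjugator $$ (r, c) \<noteq> 0" for r c
  proof -
    \<comment> \<open>\<open>?E\<close> is the reflection of \<open>mat_unit n 1 (Suc r)\<close>, so
      row \<open>r\<close> of the conjugator is the top row of \<open>\<phi> ?E\<close>.\<close>
    let ?E = "mat_unit n (Suc (n - 1 - r)) (Suc (n - 1)) :: 'k mat" and ?h = "deg (n - 1 - r) (n - 1)"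
    have "reflection n (mat_unit n 1 (Suc r)) = ?E"
      using rc reflection_mat_unit[of 1 "Suc r" n, where 'a = 'k] by simp
    then have con: "conjugator $$ (r, s) = \<phi> ?E $$ (0, s)" if "s < n" for s
      using conjugator_index[of r s] rc that by simp
    have "?h \<in> grading_supp G n (grade :: 'a \<Rightarrow> 'k mat set)"
      unfolding grading_supp_iff using n_pos by (intro exI[of _ "n - 1 - r"] exI[of _ "n - 1"]) auto
    moreover have "?E \<in> grade ?h" by (rule mat_unit_grade) simp
    ultimately have "\<phi> ?E \<in> grade (\<theta> ?h)" using \<theta> by (auto simp: theta_homogeneous_def)
    \<comment> \<open>Column \<open>r\<close> occurs too, since the diagonal of the conjugator has
      no zeros; comparing it with column \<open>c\<close> lets \<open>deg 0 r\<close>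
      cancel.\<close>
    then have "deg 0 c = \<theta> ?h" "deg 0 r = \<theta> ?h"
      using grade_deg[of "\<phi> ?E" _ 0] con[of c] con[of r] rc n_pos conjugator_diag_nonzero[of r] by auto
    then have "deg 0 r \<otimes> deg r c = deg 0 r" using deg_mult[of 0 r c] rc by simp
    then show ?thesis using deg_closed[of 0 r] deg_closed[of r c] rc by simp
  qed
  then show ?thesis using conjugator_UT by (simp add: grade_iff)
qed

end

theorem corollary3p7:
  fixes G :: "('g, 'm) monoid_scheme" (structure)
    and n :: nat
    and g :: "nat \<Rightarrow> 'g"
    and \<phi> :: "'k::field mat \<Rightarrow> 'k mat"
  assumes "CHAR('k) \<noteq> 2"
    and "group G"
    and "n \<ge> 1"
    and "\<forall>i\<in>{1..n - 1}. g i \<in> carrier G"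
    and "UT_involution n \<phi>"
  shows "homogeneous_map G n (elementary_grading G n g) \<phi> \<longleftrightarrow>
    (\<forall>i\<in>{1..n - 1}. \<forall>j\<in>{1..n - 1}. \<forall>k\<in>{1..n - i}. \<forall>l\<in>{1..n - j}.
       seg_prod G g i k = seg_prod G g j l \<longrightarrow>
       seg_prod G g (n - i - k + 1) k = seg_prod G g (n - j - l + 1) l) \<and>
    (\<exists>P Q. P \<in> elementary_grading G n g \<one> \<and> Q \<in> UT n \<and>
       inverts_mat P Q \<and> inverts_mat Q P \<and>
       (\<forall>X\<in>UT n. \<phi> X = Q * reflection n X * P) \<and>
       (even n \<longrightarrow> reflection n P = P \<or> reflection n P = - P) \<and>
       (odd n \<longrightarrow> reflection n P = P))"
proof -
  interpret elementary_UT G n g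
    using assms by (simp add: elementary_UT_def elementary_UT_axioms_def)
  have n: "0 < n" using assms by simp
  have inverts: "inverts_mat P Q \<longleftrightarrow> P * Q = 1\<^sub>m n" if "P \<in> UT n" for P Q :: "'k mat"
    using UT_carrier[OF that] by (simp add: inverts_mat_def)
  show ?thesis
    unfolding reflective_iff[symmetric]
  \<comment> \<open>The two conclusions of the forward direction are shown in one block, both from
    the same conjugator.\<close>
  proof (intro iffI conjI; (elim conjE exE)?)
    assume "homogeneous_map G n grade \<phi>"
    then obtain \<theta> where \<theta>: "theta_homogeneous G n grade \<theta> \<phi>" by (auto simp: homogeneous_map_def)
    interpret UT_monomorphism n "\<lambda>X. \<phi> (reflection n X)"
      by (rule UT_involution_reflection_monomorphism[OF assms(5) n])
    obtain Q where Q: "Q \<in> UT n" "conjugator * Q = 1\<^sub>m n" "Q * conjugator = 1\<^sub>m n"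
      and \<psi>: "\<And>X. X \<in> UT n \<Longrightarrow> \<phi> (reflection n X) = Q * X * conjugator"
      by (rule inner) blast
    \<comment> \<open>Substituting the reflection of \<open>X\<close> undoes the
      composition.\<close>
    have \<phi>: "\<phi> X = Q * reflection n X * conjugator" if "X \<in> UT n" for X
      using \<psi>[OF reflection_UT[OF that]] reflection_reflection[OF UT_carrier[OF that]] by simp
    show reflective
      by (rule reflective_if_homogeneous[OF conjugator_UT Q(1,3) \<phi> \<theta>])
    have "reflection n conjugator = conjugator \<or> even n \<and> reflection n conjugator = - conjugator"
      by (rule involution_conjugator_symmetric[OF assms(5) n conjugator_UT Q \<phi>])
    then show "\<exists>P Q. P \<in> grade \<one> \<and> Q \<in> UT n \<and> inverts_mat P Q \<and> inverts_mat Q P \<and>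
       (\<forall>X\<in>UT n. \<phi> X = Q * reflection n X * P) \<and>
       (even n \<longrightarrow> reflection n P = P \<or> reflection n P = - P) \<and>
       (odd n \<longrightarrow> reflection n P = P)"
      using conjugator_grade_one[OF assms(5) n \<theta>] Q \<phi> inverts conjugator_UT
      by (intro exI[of _ conjugator] exI[of _ Q]) auto
  next
    fix P Q
    assume refl: reflective and P: "P \<in> grade \<one>" and Q: "Q \<in> UT n"
      and PQ: "inverts_mat P Q" and QP: "inverts_mat Q P"
      and \<phi>: "\<forall>X\<in>UT n. \<phi> X = Q * reflection n X * P"
    show "homogeneous_map G n grade \<phi>"
      using homogeneous_if_reflective[OF assms(5) refl P Q] inverts[OF grade_UT[OF P]] inverts[OF Q]
        PQ QP \<phi> by blast
  qed
qed

end
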